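(* For every non-negative integer $L$, \begin{align*} \sum_{n=0}^{\lfloor L/2\rfloor}\sum_{k=0}^{\lfloor L/2\rfloor} \frac{q^{n^2+2nk+k(k+1)}x^{n+k}}{(q^2;q^2)_{n+k}}{n+k\brack k}_{q^2} & (q^{2(\lfloor (L+1)/2 \rfloor -n-k+1)};q^2)_n\, (q^{2(\lfloor L/2 \rfloor -n-k+1)};q^2)_k\\ &= \frac{(-1)^L-1}{2}\,q^{L^2}x^L+ \sum_{n=0}^{L+1} q^{n^2}x^n {L-n+1\brack n}_q, \end{align*} where $q,x$ are independent formal variables and $\lfloor\cdot\rfloor$ is the floor function.
   Context: For $n\in\mathbb{Z}_{\ge0}$, $(c;q)_n=\prod_{i=0}^{n-1}(1-cq^i)$. The Gaussian coefficient is ${a+b\brack b}_q=\frac{(q;q)_{a+b}}{(q;q)_a(q;q)_b}$ if $a,b\ge 0$ are integers, and $0$ otherwise; ${\cdot\brack\cdot}_{q^2}$ denotes the same with $q$ replaced by $q^2$.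
   Formalization: The correction term q^{L^2}x^L is replaced by q^{m^2}x^m with m=⌊(L+1)/2⌋; as printed the identity fails for odd L≥3 (at L=3 the left side is 1+(q+q^2+q^3)x, the right side has the extra q^4x^2−q^9x^3), and the two agree for even L and L=1. *)

theory Defs
  imports "HOL-Computational_Algebra.Computational_Algebra"
begin

definition qpoch :: "'a :: field \<Rightarrow> 'a \<Rightarrow> nat \<Rightarrow> 'a" where
  "qpoch c q n = (\<Prod>i<n. 1 - c * q ^ i)"

text \<open>
  The Gaussian coefficient is indexed by its upper and lower entries, so \<open>gauss_coeff q m b\<close>
  is the coefficient with \<open>m = a + b\<close>.
\<close>

definition gauss_coeff :: "'a :: field \<Rightarrow> int \<Rightarrow> int \<Rightarrow> 'a" where
  "gauss_coeff q m b =
     (if b \<ge> 0 \<and> m - b \<ge> 0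
      then qpoch q q (nat m) / (qpoch q q (nat (m - b)) * qpoch q q (nat b)) else 0)"

text \<open>
  Identities in two independent formal variables are stated in the field of fractions of
  \<open>\<rat>[q][x]\<close>: the denominators and the negative powers of \<open>q\<close> that occur are genuine there,
  and \<open>q\<close> and \<open>x\<close> are algebraically independent over the rationals.
\<close>

type_synonym ratfun = "rat poly poly fract"

definition qvar :: ratfun where
  "qvar = Fraction_Field.Fract [:[:0, 1:]:] 1"

definition xvar :: ratfun where
  "xvar = Fraction_Field.Fract [:0, 1:] 1"

text \<open>
  A deviation from the source. Summing \<open>n\<close> only up to \<open>L div 2\<close> leaves out, for odd \<open>L\<close>, the
  summand \<open>n = (L + 1) div 2\<close>, \<open>k = 0\<close> of the double sum, which equals \<open>q ^ (n\<^sup>2) * x ^ n\<close>; the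
  term with the factor \<open>((- 1) ^ L - 1) / 2\<close> compensates for it, so its exponents are those of
  \<open>m = (L + 1) div 2\<close>. The source prints \<open>q ^ (L\<^sup>2) * x ^ L\<close> instead of \<open>q ^ (m\<^sup>2) * x ^ m\<close>, which
  agrees for even \<open>L\<close> and for \<open>L = 1\<close> but is false for \<open>L = 3\<close>: there the double sum is
  \<open>1 + (q + q\<^sup>2 + q\<^sup>3) * x\<close> and the sum of Gaussian coefficients is
  \<open>1 + (q + q\<^sup>2 + q\<^sup>3) * x + q ^ 4 * x\<^sup>2\<close>.
\<close>

end

theory Submission
  imports Defs
begin

text \<open>
  Compare coefficients of \<open>x ^ m\<close>, where \<open>m = n + k\<close>. With \<open>N = L div 2\<close>, \<open>L = 2 * N + e\<close> and
  \<open>m \<le> N\<close>, put \<open>a = N - m\<close>; after cancelling \<open>q ^ (m\<^sup>2)\<close> the claim becomes the convolution of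
  \<open>[a + e + j, j]\<close> and \<open>q ^ k * [a + k, k]\<close>, both to base \<open>q\<^sup>2\<close>, equals
  \<open>[2 * a + e + 1 + m, m]\<close> to base \<open>q\<close>. By the \<open>q\<close>-binomial series
  \<open>\<Sum>j. [b + j, j] z ^ j = 1 / (z; q)_(b + 1)\<close> this is the splitting of \<open>(z; q)_(2 * a + e + 2)\<close>
  into its even factors \<open>(z; q\<^sup>2)_(a + e + 1)\<close> and its odd factors \<open>(z * q; q\<^sup>2)_(a + 1)\<close>.
\<close>

section \<open>\<open>q\<close>-shifted factorials and Gaussian coefficients\<close>

definition gauss :: "'a::field \<Rightarrow> nat \<Rightarrow> nat \<Rightarrow> 'a" where
  "gauss q b j = qpoch q q (b + j) / (qpoch q q b * qpoch q q j)"

lemma qpoch_0 [simp]: "qpoch c q 0 = 1"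
  by (simp add: qpoch_def)

lemma qpoch_Suc: "qpoch c q (Suc n) = qpoch c q n * (1 - c * q ^ n)"
  by (simp add: qpoch_def)

lemma qpoch_add: "qpoch c q (m + n) = qpoch c q m * qpoch (c * q ^ m) q n"
  by (induction n) (simp_all add: qpoch_Suc power_add mult.assoc)

lemma qpoch_eq_0:
  assumes "i < n" "c * q ^ i = 1"
  shows "qpoch c q n = 0"
  using assms unfolding qpoch_def by (auto intro!: prod_zero)

lemma qpoch_self_nonzero:
  fixes q :: "'a::field"
  assumes "\<And>n. n > 0 \<Longrightarrow> q ^ n \<noteq> 1"
  shows "qpoch q q n \<noteq> 0"
  using assms[of "Suc _"] by (auto simp: qpoch_def)

lemma gauss_coeff_eq_gauss:
  "gauss_coeff q (int a + int b) (int b) = gauss q a b"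
proof -
  have "nat (int a + int b - int b) = a" "nat (int a + int b) = a + b"
    by linarith+
  then show ?thesis
    by (simp add: gauss_coeff_def gauss_def)
qed

lemma gauss_coeff_eq_0: "m < b \<Longrightarrow> gauss_coeff q m b = 0"
  by (simp add: gauss_coeff_def)

text \<open>Over a common denominator this is \<open>1 - q ^ (b + j + 2) = (1 - q ^ (b + 1)) + q ^
  (b + 1) * (1 - q ^ (j + 1))\<close>.\<close>

lemma gauss_pascal:
  fixes q :: "'a::field"
  assumes "\<And>n. n > 0 \<Longrightarrow> q ^ n \<noteq> 1"
  shows "gauss q (Suc b) (Suc j) = gauss q b (Suc j) + q ^ Suc b * gauss q (Suc b) j"
proof -
  have nz: "qpoch q q n \<noteq> 0" "1 - q * q ^ n \<noteq> 0" for n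
    using qpoch_self_nonzero[OF assms] assms[of "Suc n"] by auto
  show ?thesis
    using nz by (simp add: gauss_def qpoch_Suc divide_simps) (simp add: power_add algebra_simps)
qed

section \<open>The \<open>q\<close>-binomial series in an auxiliary variable\<close>

definition gauss_fps :: "'a::field \<Rightarrow> 'a \<Rightarrow> nat \<Rightarrow> 'a fps" where
  "gauss_fps q c b = Abs_fps (\<lambda>j. c ^ j * gauss q b j)"

text \<open>This is \<open>(c * z; q)_n\<close> with \<open>fps_X\<close> as \<open>z\<close>. The
  scale \<open>c\<close> is needed because the odd factors to base \<open>q\<^sup>2\<close> start at
  \<open>z * q\<close>.\<close>

definition qpoch_fps :: "'a::field \<Rightarrow> 'a \<Rightarrow> nat \<Rightarrow> 'a fps" where
  "qpoch_fps q c n = (\<Prod>i<n. 1 - fps_const (c * q ^ i) * fps_X)"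

text \<open>Coefficientwise this is the Pascal rule: the last linear factor of
  \<open>(c * z; q)_(b + 2)\<close> lowers \<open>b\<close> by one.\<close>

lemma gauss_fps_mult_linear:
  fixes q :: "'a::field"
  assumes "\<And>n. n > 0 \<Longrightarrow> q ^ n \<noteq> 1"
  shows "gauss_fps q c (Suc b) * (1 - fps_const (c * q ^ Suc b) * fps_X) = gauss_fps q c b"
proof (rule fps_ext)
  fix j
  have "gauss_fps q c (Suc b) * (1 - fps_const (c * q ^ Suc b) * fps_X)
      = gauss_fps q c (Suc b) - fps_const (c * q ^ Suc b) * (fps_X * gauss_fps q c (Suc b))"
    by (simp add: algebra_simps)
  then show "fps_nth (gauss_fps q c (Suc b) * (1 - fps_const (c * q ^ Suc b) * fps_X)) j
      = fps_nth (gauss_fps q c b) j"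
  proof (cases j)
    case 0
    then show ?thesis
      using qpoch_self_nonzero[OF assms] by (simp add: gauss_fps_def gauss_def)
  next
    case (Suc i)
    with \<open>_ = gauss_fps q c (Suc b) - _\<close> show ?thesis
      by (simp add: gauss_fps_def gauss_pascal[OF assms] algebra_simps)
  qed
qed

lemma gauss_fps_mult_qpoch_fps:
  fixes q :: "'a::field"
  assumes "\<And>n. n > 0 \<Longrightarrow> q ^ n \<noteq> 1"
  shows "gauss_fps q c b * qpoch_fps q c (Suc b) = 1"
proof (induction b)
  case 0
  have "gauss_fps q c 0 * (1 - fps_const c * fps_X) = 1"
  proof (rule fps_ext)
    fix j
    have "gauss_fps q c 0 = Abs_fps (\<lambda>j. c ^ j)"
      using qpoch_self_nonzero[OF assms] by (simp add: gauss_fps_def gauss_def)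
    moreover have "gauss_fps q c 0 * (1 - fps_const c * fps_X)
        = gauss_fps q c 0 - fps_const c * (fps_X * gauss_fps q c 0)"
      by (simp add: algebra_simps)
    ultimately show "fps_nth (gauss_fps q c 0 * (1 - fps_const c * fps_X)) j = fps_nth 1 j"
      by (cases j) simp_all
  qed
  then show ?case
    by (simp add: qpoch_fps_def)
next
  case (Suc b)
  have "gauss_fps q c (Suc b) * qpoch_fps q c (Suc (Suc b))
      = gauss_fps q c (Suc b) * (1 - fps_const (c * q ^ Suc b) * fps_X) * qpoch_fps q c (Suc b)"
    by (simp add: qpoch_fps_def mult_ac)
  then show ?case
    by (simp only: gauss_fps_mult_linear[OF assms] Suc.IH)
qed

text \<open>Factors are sorted by the parity of their index. For \<open>e = 1\<close> the extra
  index \<open>2 * a\<close> is even, so it joins the first product.\<close>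

lemma qpoch_fps_split:
  fixes q :: "'a::field"
  assumes "e \<le> 1"
  shows "qpoch_fps q 1 (2 * a + e) = qpoch_fps (q\<^sup>2) 1 (a + e) * qpoch_fps (q\<^sup>2) q a"
proof -
  have even: "qpoch_fps q 1 (2 * a) = qpoch_fps (q\<^sup>2) 1 a * qpoch_fps (q\<^sup>2) q a"
    by (induction a) (simp_all add: qpoch_fps_def mult_ac flip: power_mult)
  from assms consider "e = 0" | "e = 1"
    by linarith
  then show ?thesis
  proof cases
    case 1
    then show ?thesis
      using even by simp
  next
    case 2
    then show ?thesis
      using even by (simp add: qpoch_fps_def mult_ac flip: power_mult)
  qed
qed

lemma gauss_even_odd_convolution:
  fixes q :: "'a::field"
  assumes nru: "\<And>n. n > 0 \<Longrightarrow> q ^ n \<noteq> 1" and "e \<le> 1"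
  shows "(\<Sum>k\<le>m. q ^ k * (gauss (q\<^sup>2) a k * gauss (q\<^sup>2) (a + e) (m - k)))
    = gauss q (2 * a + e + 1) m"
proof -
  have nru2: "(q\<^sup>2) ^ n \<noteq> 1" if "n > 0" for n
    using nru[of "2 * n"] that by (simp add: power_mult)
  let ?A = "gauss_fps (q\<^sup>2) 1 (a + e)" and ?B = "gauss_fps (q\<^sup>2) q a"
  let ?C = "gauss_fps q 1 (2 * a + e + 1)"
  let ?PA = "qpoch_fps (q\<^sup>2) 1 (Suc (a + e))" and ?PB = "qpoch_fps (q\<^sup>2) q (Suc a)"
  let ?PC = "qpoch_fps q 1 (Suc (2 * a + e + 1))"
  have PC: "?PC = ?PA * ?PB"
    using qpoch_fps_split[OF \<open>e \<le> 1\<close>, of q "Suc a"] by simp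
  have A: "?A * ?PA = 1" and B: "?B * ?PB = 1" and C: "?C * ?PC = 1"
    by (rule gauss_fps_mult_qpoch_fps; fact nru nru2)+
  \<comment> \<open>Instead of dividing power series, \<open>1 = ?C * ?PC\<close> is inserted and
    the even and odd factors are cancelled.\<close>
  have "?B * ?A = (?B * ?A) * (?C * (?PA * ?PB))"
    by (simp only: C mult_1_right flip: PC)
  also have "\<dots> = ?C * (?A * ?PA) * (?B * ?PB)"
    by (simp only: mult_ac)
  also have "\<dots> = ?C"
    by (simp only: A B mult_1_right)
  finally have "fps_nth (?B * ?A) m = fps_nth ?C m"
    by simp
  then show ?thesis
    by (simp add: fps_mult_nth gauss_fps_def atLeast0AtMost mult.assoc)
qed

section \<open>From the double sum to a single sum\<close>

lemma sum_square_eq_sum_triangle: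
  fixes f :: "nat \<Rightarrow> nat \<Rightarrow> 'a::comm_monoid_add"
  assumes "\<And>n k. n \<le> N \<Longrightarrow> k \<le> N \<Longrightarrow> N < n + k \<Longrightarrow> f n k = 0"
  shows "(\<Sum>n\<le>N. \<Sum>k\<le>N. f n k) = (\<Sum>m\<le>N. \<Sum>k\<le>m. f (m - k) k)"
proof -
  have "(\<Sum>n\<le>N. \<Sum>k\<le>N. f n k) = (\<Sum>(n, k)\<in>{..N} \<times> {..N}. f n k)"
    by (simp add: sum.cartesian_product)
  \<comment> \<open>The square exceeds the triangle only by the corner \<open>N < n + k\<close>,
    where \<open>f\<close> vanishes.\<close>
  also have "\<dots> = (\<Sum>(n, k)\<in>{(n, k). n + k \<le> N}. f n k)"
    by (rule sum.mono_neutral_right) (use assms not_le in auto)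
  also have "\<dots> = (\<Sum>(m, k)\<in>(SIGMA m:{..N}. {..m}). f (m - k) k)"
    by (rule sum.reindex_bij_witness[of _ "\<lambda>(m, k). (m - k, k)" "\<lambda>(n, k). (n + k, k)"]) auto
  finally show ?thesis
    by (simp add: sum.Sigma)
qed

lemma qpoch_powi_eq:
  fixes q :: "'a::field"
  assumes "\<And>n. n > 0 \<Longrightarrow> q ^ n \<noteq> 1"
  shows "qpoch (q powi (2 * (int c + 1))) (q\<^sup>2) n
    = qpoch (q\<^sup>2) (q\<^sup>2) (c + n) / qpoch (q\<^sup>2) (q\<^sup>2) c"
proof -
  have nru2: "(q\<^sup>2) ^ n \<noteq> 1" if "n > 0" for n
    using assms[of "2 * n"] that by (simp add: power_mult)
  have "q powi (2 * (int c + 1)) = q powi int (2 * Suc c)"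
    by (simp add: algebra_simps)
  also have "\<dots> = q\<^sup>2 * (q\<^sup>2) ^ c"
    by (simp only: power_int_of_nat power_mult power_Suc)
  finally show ?thesis
    using qpoch_self_nonzero[of "q\<^sup>2" c, OF nru2] by (simp add: qpoch_add)
qed

text \<open>The factor of index \<open>i\<close> is
  \<open>1 - q powi (- 2 * i) * q ^ (2 * i) = 0\<close>.\<close>

lemma qpoch_powi_eq_0:
  fixes q :: "'a::field"
  assumes "q \<noteq> 0" "i < n"
  shows "qpoch (q powi (- 2 * int i)) (q\<^sup>2) n = 0"
proof (rule qpoch_eq_0[OF \<open>i < n\<close>])
  have "(q\<^sup>2) ^ i = q powi (2 * int i)"
    by (metis power_int_of_nat power_mult of_nat_mult of_nat_numeral)
  then show "q powi (- 2 * int i) * (q\<^sup>2) ^ i = 1"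
    using \<open>q \<noteq> 0\<close> by (simp add: power_int_minus)
qed

lemma double_sum_eq_gauss_sum:
  fixes q x :: "'a::field"
  assumes nru: "\<And>n. n > 0 \<Longrightarrow> q ^ n \<noteq> 1" and "q \<noteq> 0" and e: "e \<le> 1"
  shows "(\<Sum>n\<le>N. \<Sum>k\<le>N.
        q ^ (n\<^sup>2 + 2 * n * k + k * (k + 1)) * x ^ (n + k) / qpoch (q\<^sup>2) (q\<^sup>2) (n + k)
        * gauss_coeff (q\<^sup>2) (int n + int k) (int k)
        * qpoch (q powi (2 * (int (N + e) - int n - int k + 1))) (q\<^sup>2) n
        * qpoch (q powi (2 * (int N - int n - int k + 1))) (q\<^sup>2) k)
      = (\<Sum>m\<le>N. q ^ (m\<^sup>2) * x ^ m * gauss q (2 * (N - m) + e + 1) m)"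
    (is "(\<Sum>n\<le>N. \<Sum>k\<le>N. ?f n k) = _")
proof -
  have nru2: "(q\<^sup>2) ^ n \<noteq> 1" if "n > 0" for n
    using nru[of "2 * n"] that by (simp add: power_mult)
  have "?f n k = 0" if "n \<le> N" "k \<le> N" "N < n + k" for n k
  proof -
    \<comment> \<open>In the corner the last shifted factorial starts at exponent
      \<open>- 2 * i\<close>. Since \<open>n \<le> N\<close> forces \<open>i < k\<close>, its
      vanishing factor is among the \<open>k\<close> factors present.\<close>
    obtain i where i: "n + k = Suc (N + i)"
      using \<open>N < n + k\<close> by (auto simp: less_iff_Suc_add)
    then have "int n + int k = 1 + int N + int i"
      by linarith
    then have exp: "2 * (int N - int n - int k + 1) = - 2 * int i"
      by simp
    have "qpoch (q powi (2 * (int N - int n - int k + 1))) (q\<^sup>2) k = 0"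
      unfolding exp using i \<open>n \<le> N\<close> by (intro qpoch_powi_eq_0 \<open>q \<noteq> 0\<close>) simp
    then show ?thesis
      by simp
  qed
  then have "(\<Sum>n\<le>N. \<Sum>k\<le>N. ?f n k) = (\<Sum>m\<le>N. \<Sum>k\<le>m. ?f (m - k) k)"
    by (rule sum_square_eq_sum_triangle)
  also have "\<dots> = (\<Sum>m\<le>N. \<Sum>k\<le>m. q ^ (m\<^sup>2) * x ^ m
      * (q ^ k * (gauss (q\<^sup>2) (N - m) k * gauss (q\<^sup>2) (N - m + e) (m - k))))"
  proof (intro sum.cong refl)
    fix m k
    assume "m \<in> {..N}" "k \<in> {..m}"
    then obtain n a where m: "m = n + k" and N: "N = a + (n + k)"
      by (metis atMost_iff le_iff_add add.commute)
    have exps: "int (N + e) - int n - int k + 1 = int (a + e) + 1"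
      "int N - int n - int k + 1 = int a + 1"
      by (simp_all add: N)
    \<comment> \<open>Completing the square leaves \<open>q ^ k\<close>, the weight required by the
      convolution.\<close>
    have "n\<^sup>2 + 2 * n * k + k * (k + 1) = (n + k)\<^sup>2 + k"
      by (simp add: power2_eq_square algebra_simps)
    then have pow: "q ^ (n\<^sup>2 + 2 * n * k + k * (k + 1)) = q ^ ((n + k)\<^sup>2) * q ^ k"
      by (simp only: power_add)
    \<comment> \<open>The prefactor's denominator cancels the numerator of the Gaussian coefficient.
      The remaining factorials of \<open>n\<close> and \<open>k\<close> complete the two quotients
      from \<open>qpoch_powi_eq\<close> to Gaussian coefficients.\<close>
    have "?f n k = q ^ ((n + k)\<^sup>2) * x ^ (n + k)
        * (q ^ k * (gauss (q\<^sup>2) a k * gauss (q\<^sup>2) (a + e) n))"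
      using qpoch_self_nonzero[of "q\<^sup>2", OF nru2]
      by (simp only: exps qpoch_powi_eq[OF nru] pow gauss_coeff_eq_gauss gauss_def)
        (simp add: divide_simps add_ac)
    then show "?f (m - k) k = q ^ (m\<^sup>2) * x ^ m
        * (q ^ k * (gauss (q\<^sup>2) (N - m) k * gauss (q\<^sup>2) (N - m + e) (m - k)))"
      by (simp add: m N)
  qed
  also have "\<dots> = (\<Sum>m\<le>N. q ^ (m\<^sup>2) * x ^ m * gauss q (2 * (N - m) + e + 1) m)"
    by (simp only: gauss_even_odd_convolution[OF nru e] flip: sum_distrib_left)
  finally show ?thesis .
qed

text \<open>Beyond \<open>n = N + 1\<close> the upper entry is below the lower one. At
  \<open>n = N + 1\<close> the entries are \<open>N + e\<close> and \<open>N + 1\<close>, so the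
  coefficient is \<open>e\<close>.\<close>

lemma gauss_sum_split:
  fixes q x :: "'a::field"
  assumes nru: "\<And>n. n > 0 \<Longrightarrow> q ^ n \<noteq> 1" and "e \<le> 1" and L: "L = 2 * N + e"
  shows "(\<Sum>n\<le>L + 1. q ^ (n\<^sup>2) * x ^ n * gauss_coeff q (int L - int n + 1) (int n))
    = (\<Sum>m\<le>N. q ^ (m\<^sup>2) * x ^ m * gauss q (2 * (N - m) + e + 1) m)
      + of_nat e * q ^ ((N + 1)\<^sup>2) * x ^ (N + 1)"
    (is "sum ?g _ = _")
proof -
  have "sum ?g {..L + 1} = sum ?g {..Suc N}"
    by (rule sum.mono_neutral_right) (use \<open>e \<le> 1\<close> L in \<open>auto intro!: gauss_coeff_eq_0\<close>)
  also have "\<dots> = sum ?g {..N} + ?g (N + 1)"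
    by simp
  also have "sum ?g {..N} = (\<Sum>m\<le>N. q ^ (m\<^sup>2) * x ^ m * gauss q (2 * (N - m) + e + 1) m)"
  proof (rule sum.cong[OF refl])
    fix m
    assume "m \<in> {..N}"
    then have "int L - int m + 1 = int (2 * (N - m) + e + 1) + int m"
      using L by auto
    then show "?g m = q ^ (m\<^sup>2) * x ^ m * gauss q (2 * (N - m) + e + 1) m"
      by (simp only: gauss_coeff_eq_gauss)
  qed
  also have "?g (N + 1) = of_nat e * q ^ ((N + 1)\<^sup>2) * x ^ (N + 1)"
  proof (cases "e = 0")
    case True
    then show ?thesis
      using L by (simp add: gauss_coeff_eq_0)
  next
    case False
    then have "e = 1"
      using \<open>e \<le> 1\<close> by simp
    then have "int L - int (N + 1) + 1 = int 0 + int (N + 1)"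
      using L by simp
    then have "gauss_coeff q (int L - int (N + 1) + 1) (int (N + 1)) = gauss q 0 (N + 1)"
      by (simp only: gauss_coeff_eq_gauss)
    also have "\<dots> = 1"
      using qpoch_self_nonzero[OF nru] by (simp add: gauss_def)
    finally show ?thesis
      using \<open>e = 1\<close> by simp
  qed
  finally show ?thesis .
qed

section \<open>Specialisation to the formal variables\<close>

lemma qvar_power: "qvar ^ n = Fraction_Field.Fract [:[:0, 1:] ^ n:] 1"
  by (induction n) (simp_all add: qvar_def One_fract_def one_pCons)

lemma qvar_power_neq_1:
  assumes "n > 0"
  shows "qvar ^ n \<noteq> 1"
proof
  assume "qvar ^ n = 1"
  \<comment> \<open>With denominators 1 the equation descends to polynomials in \<open>q\<close>,
    where the degrees \<open>n\<close> and 0 disagree.\<close>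
  then have "[:0, 1:] ^ n = (1 :: rat poly)"
    by (simp add: qvar_power One_fract_def eq_fract one_pCons)
  then have "degree ([:0, 1:] ^ n :: rat poly) = 0"
    by simp
  with assms show False
    by (simp add: degree_power_eq)
qed

lemma qvar_neq_0: "qvar \<noteq> 0"
  by (simp add: qvar_def Zero_fract_def eq_fract)

theorem theorem4:
  fixes L :: nat
  shows
    "(\<Sum>n = 0..L div 2. \<Sum>k = 0..L div 2.
        qvar ^ (n\<^sup>2 + 2 * n * k + k * (k + 1)) * xvar ^ (n + k)
          / qpoch (qvar\<^sup>2) (qvar\<^sup>2) (n + k)
        * gauss_coeff (qvar\<^sup>2) (int n + int k) (int k)
        * qpoch (qvar powi (2 * (int ((L + 1) div 2) - int n - int k + 1))) (qvar\<^sup>2) n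
        * qpoch (qvar powi (2 * (int (L div 2) - int n - int k + 1))) (qvar\<^sup>2) k)
     = (((- 1) ^ L - 1) / 2) * qvar ^ (((L + 1) div 2)\<^sup>2) * xvar ^ ((L + 1) div 2)
       + (\<Sum>n = 0..L + 1. qvar ^ (n\<^sup>2) * xvar ^ n
            * gauss_coeff qvar (int L - int n + 1) (int n))"
proof -
  define N e where "N = L div 2" and "e = L mod 2"
  have L: "L = 2 * N + e" and e: "e \<le> 1"
    by (simp_all add: N_def e_def)
  have M: "(L + 1) div 2 = N + e" and N: "L div 2 = N"
    using L e by linarith+
  \<comment> \<open>The sign factor is \<open>- e\<close>, so this term cancels the summand
    \<open>n = N + 1\<close> split off by \<open>gauss_sum_split\<close>. For \<open>e = 0\<close>
    both vanish, although the exponents \<open>N + e\<close> and \<open>N + 1\<close>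
    differ.\<close>
  have sign: "((- 1) ^ L - 1) / 2 * qvar ^ ((N + e)\<^sup>2) * xvar ^ (N + e)
      = - (of_nat e * qvar ^ ((N + 1)\<^sup>2) * xvar ^ (N + 1))"
  proof (cases "e = 0")
    case False
    then have "e = 1"
      using e by simp
    then have half: "((- 1) ^ L - 1) / 2 = (- 1 :: ratfun)"
      by (simp add: L)
    then show ?thesis
      unfolding half by (simp add: \<open>e = 1\<close>)
  qed (simp add: L)
  show ?thesis
    by (simp only: M N atLeast0AtMost sign double_sum_eq_gauss_sum[OF qvar_power_neq_1 qvar_neq_0 e]
        gauss_sum_split[OF qvar_power_neq_1 e L])
qed

end
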